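(* Let $p$ be a prime number, let $\lambda:\mathbb Z/p\curvearrowright\mathcal G$ be an action by automorphisms on an ample groupoid $\mathcal G$ whose unit space is a Cantor set, free on $\mathcal G^{(0)}$, and put $\mathcal H:=\mathcal G\rtimes_\lambda\mathbb Z/p$. Assume that $\mathcal G$ and $\mathcal H$ are effective, minimal, and each either almost finite or purely infinite. Then the wide open subgroupoid $\mathcal G=\mathcal G\times\{0\}\subset\mathcal H$ is prime.
   Context: An étale groupoid is a second countable locally compact Hausdorff topological groupoid whose range map is a local homeomorphism; $\mathcal G^{(0)}$ is the unit space, $s(g)=g^{-1}g$, $r(g)=gg^{-1}$. It is ample if $\mathcal G^{(0)}$ is totally disconnected. A bisection is a subset on which $r$ and $s$ are injective. $\mathcal G$ is minimal if every orbit $r(s^{-1}(x))$ is dense in $\mathcal G^{(0)}$; effective if the interior of $\{g\mid r(g)=s(g)\}$ is $\mathcal G^{(0)}$; principal if $\{g\mid r(g)=s(g)\}=\mathcal G^{(0)}$. A subgroupoid $\mathcal K\subset\mathcal H$ is wide if $\mathcal K^{(0)}=\mathcal H^{(0)}$. A wide open subgroupoid $\mathcal G\subset\mathcal H$ is prime if every wide open subgroupoid $\mathcal K\subset\mathcal H$ containing $\mathcal G$ equals either $\mathcal H$ or $\mathcal G$. An elementary subgroupoid is a compact open principal subgroupoid $\mathcal K\subset\mathcal G$ with $\mathcal K^{(0)}=\mathcal G^{(0)}$; $\mathcal Kx=\{g\in\mathcal K\mid s(g)=x\}$. $\mathcal G$ (with compact unit space) is almost finite if for every compact $C\subset\mathcal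 G$ and $\varepsilon>0$ there is an elementary subgroupoid $\mathcal K$ with $\#(C\mathcal Kx\setminus\mathcal Kx)/\#(\mathcal Kx)<\varepsilon$ for all $x\in\mathcal G^{(0)}$. It is purely infinite if for every clopen $A\subset\mathcal G^{(0)}$ there are compact open bisections $U,V$ with $s(U)=s(V)=A$, $r(U)\cap r(V)=\emptyset$, $r(U)\cup r(V)\subset A$. $\mathcal G\rtimes_\lambda\mathbb Z/p$ is $\mathcal G\times\mathbb Z/p$ with the product topology, unit space identified with $\mathcal G^{(0)}$, $r(g,a)=r(g)$, $s(g,a)=\lambda_a^{-1}(s(g))$, $(g,a)(h,b)=(g\lambda_a(h),a+b)$. *)

theory Defs
  imports "HOL-Analysis.Analysis" "HOL-Algebra.Elementary_Groups"
begin

section \<open>Topological groupoids\<close>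

text \<open>
  A groupoid is given by its arrow space, whose underlying set is the set of arrows, together with
  multiplication and inversion. Both operations are total functions; products are meaningful only
  for pairs of arrows in \<open>comp_pairs\<close>.
\<close>

record 'g top_groupoid =
  gtop :: "'g topology"
  gmult :: "'g \<Rightarrow> 'g \<Rightarrow> 'g"
  ginv :: "'g \<Rightarrow> 'g"

definition arrows :: "'g top_groupoid \<Rightarrow> 'g set" where
  "arrows G = topspace (gtop G)"

definition src :: "'g top_groupoid \<Rightarrow> 'g \<Rightarrow> 'g" where
  "src G g = gmult G (ginv G g) g"

definition rng :: "'g top_groupoid \<Rightarrow> 'g \<Rightarrow> 'g" where
  "rng G g = gmult G g (ginv G g)"

definition unit_space :: "'g top_groupoid \<Rightarrow> 'g set" where
  "unit_space G = src G ` arrows G"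

definition unit_top :: "'g top_groupoid \<Rightarrow> 'g topology" where
  "unit_top G = subtopology (gtop G) (unit_space G)"

definition comp_pairs :: "'g top_groupoid \<Rightarrow> ('g \<times> 'g) set" where
  "comp_pairs G = {(g, h). g \<in> arrows G \<and> h \<in> arrows G \<and> src G g = rng G h}"

definition groupoid :: "'g top_groupoid \<Rightarrow> bool" where
  "groupoid G \<longleftrightarrow>
     (\<forall>g\<in>arrows G. ginv G g \<in> arrows G \<and> src G (ginv G g) = rng G g \<and> rng G (ginv G g) = src G g) \<and>
     (\<forall>(g, h)\<in>comp_pairs G.
        gmult G g h \<in> arrows G \<and> src G (gmult G g h) = src G h \<and> rng G (gmult G g h) = rng G g) \<and>
     (\<forall>g h k. (g, h) \<in> comp_pairs G \<and> (h, k) \<in> comp_pairs G \<longrightarrow>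
        gmult G (gmult G g h) k = gmult G g (gmult G h k)) \<and>
     (\<forall>g\<in>arrows G. gmult G g (src G g) = g \<and> gmult G (rng G g) g = g)"

definition topological_groupoid :: "'g top_groupoid \<Rightarrow> bool" where
  "topological_groupoid G \<longleftrightarrow> groupoid G \<and>
     continuous_map (gtop G) (gtop G) (ginv G) \<and>
     continuous_map (subtopology (prod_topology (gtop G) (gtop G)) (comp_pairs G)) (gtop G)
       (\<lambda>(g, h). gmult G g h)"

definition local_homeomorphism :: "'a topology \<Rightarrow> 'b topology \<Rightarrow> ('a \<Rightarrow> 'b) \<Rightarrow> bool" where
  "local_homeomorphism X Y f \<longleftrightarrow>
     (\<forall>x\<in>topspace X. \<exists>U V. openin X U \<and> x \<in> U \<and> openin Y V \<and>
        homeomorphic_map (subtopology X U) (subtopology Y V) f)"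

definition etale_groupoid :: "'g top_groupoid \<Rightarrow> bool" where
  "etale_groupoid G \<longleftrightarrow> topological_groupoid G \<and>
     second_countable (gtop G) \<and> locally_compact_space (gtop G) \<and> Hausdorff_space (gtop G) \<and>
     local_homeomorphism (gtop G) (unit_top G) (rng G)"

definition totally_disconnected_space :: "'a topology \<Rightarrow> bool" where
  "totally_disconnected_space X \<longleftrightarrow>
     (\<forall>C. connectedin X C \<longrightarrow> (\<forall>x\<in>C. \<forall>y\<in>C. x = y))"

definition ample_groupoid :: "'g top_groupoid \<Rightarrow> bool" where
  "ample_groupoid G \<longleftrightarrow> etale_groupoid G \<and> totally_disconnected_space (unit_top G)"

definition cantor_space :: "'a topology \<Rightarrow> bool" where
  "cantor_space X \<longleftrightarrow>
     X homeomorphic_space product_topology (\<lambda>_::nat. discrete_topology (UNIV :: bool set)) UNIV"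

definition isotropy :: "'g top_groupoid \<Rightarrow> 'g set" where
  "isotropy G = {g \<in> arrows G. rng G g = src G g}"

definition principal :: "'g top_groupoid \<Rightarrow> bool" where
  "principal G \<longleftrightarrow> isotropy G = unit_space G"

definition effective :: "'g top_groupoid \<Rightarrow> bool" where
  "effective G \<longleftrightarrow> gtop G interior_of isotropy G = unit_space G"

definition groupoid_orbit :: "'g top_groupoid \<Rightarrow> 'g \<Rightarrow> 'g set" where
  "groupoid_orbit G x = rng G ` {g \<in> arrows G. src G g = x}"

definition minimal :: "'g top_groupoid \<Rightarrow> bool" where
  "minimal G \<longleftrightarrow>
     (\<forall>x\<in>unit_space G. unit_top G closure_of groupoid_orbit G x = unit_space G)"

section \<open>Subgroupoids\<close>

definition subgroupoid :: "'g set \<Rightarrow> 'g top_groupoid \<Rightarrow> bool" where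
  "subgroupoid K G \<longleftrightarrow> K \<subseteq> arrows G \<and> (\<forall>g\<in>K. ginv G g \<in> K) \<and>
     (\<forall>g\<in>K. \<forall>h\<in>K. (g, h) \<in> comp_pairs G \<longrightarrow> gmult G g h \<in> K)"

definition restrict_groupoid :: "'g top_groupoid \<Rightarrow> 'g set \<Rightarrow> 'g top_groupoid" where
  "restrict_groupoid G K = G\<lparr>gtop := subtopology (gtop G) K\<rparr>"

definition wide_subgroupoid :: "'g set \<Rightarrow> 'g top_groupoid \<Rightarrow> bool" where
  "wide_subgroupoid K G \<longleftrightarrow> subgroupoid K G \<and> unit_space (restrict_groupoid G K) = unit_space G"

definition wide_open_subgroupoid :: "'g set \<Rightarrow> 'g top_groupoid \<Rightarrow> bool" where
  "wide_open_subgroupoid K G \<longleftrightarrow> wide_subgroupoid K G \<and> openin (gtop G) K"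

definition prime_subgroupoid :: "'g set \<Rightarrow> 'g top_groupoid \<Rightarrow> bool" where
  "prime_subgroupoid K H \<longleftrightarrow> wide_open_subgroupoid K H \<and>
     (\<forall>L. wide_open_subgroupoid L H \<and> K \<subseteq> L \<longrightarrow> L = arrows H \<or> L = K)"

definition elementary_subgroupoid :: "'g set \<Rightarrow> 'g top_groupoid \<Rightarrow> bool" where
  "elementary_subgroupoid K G \<longleftrightarrow> wide_open_subgroupoid K G \<and> compactin (gtop G) K \<and>
     principal (restrict_groupoid G K)"

section \<open>Almost finite and purely infinite groupoids\<close>

definition set_prod :: "'g top_groupoid \<Rightarrow> 'g set \<Rightarrow> 'g set \<Rightarrow> 'g set" where
  "set_prod G A B = {gmult G a b | a b. a \<in> A \<and> b \<in> B \<and> (a, b) \<in> comp_pairs G}"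

definition src_fibre :: "'g top_groupoid \<Rightarrow> 'g set \<Rightarrow> 'g \<Rightarrow> 'g set" where
  "src_fibre G K x = {g \<in> K. src G g = x}"

text \<open>
  Compactness of the unit space need not be required separately: it is the image under the source
  map of any elementary subgroupoid. In an etale groupoid the sets counted below are finite,
  since fibres of the source map are discrete.
\<close>

definition almost_finite :: "'g top_groupoid \<Rightarrow> bool" where
  "almost_finite G \<longleftrightarrow>
     (\<forall>C. \<forall>\<epsilon>::real. compactin (gtop G) C \<and> \<epsilon> > 0 \<longrightarrow>
        (\<exists>K. elementary_subgroupoid K G \<and>
           (\<forall>x\<in>unit_space G.
              real (card (set_prod G C (src_fibre G K x) - src_fibre G K x))
                / real (card (src_fibre G K x)) < \<epsilon>)))"

definition bisection :: "'g set \<Rightarrow> 'g top_groupoid \<Rightarrow> bool" where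
  "bisection U G \<longleftrightarrow> U \<subseteq> arrows G \<and> inj_on (rng G) U \<and> inj_on (src G) U"

definition compact_open_bisection :: "'g set \<Rightarrow> 'g top_groupoid \<Rightarrow> bool" where
  "compact_open_bisection U G \<longleftrightarrow>
     bisection U G \<and> compactin (gtop G) U \<and> openin (gtop G) U"

definition purely_infinite :: "'g top_groupoid \<Rightarrow> bool" where
  "purely_infinite G \<longleftrightarrow>
     (\<forall>A. openin (unit_top G) A \<and> closedin (unit_top G) A \<longrightarrow>
        (\<exists>U V. compact_open_bisection U G \<and> compact_open_bisection V G \<and>
           src G ` U = A \<and> src G ` V = A \<and>
           rng G ` U \<inter> rng G ` V = {} \<and> rng G ` U \<union> rng G ` V \<subseteq> A))"

section \<open>Actions and semidirect products\<close>

definition groupoid_automorphism :: "'g top_groupoid \<Rightarrow> ('g \<Rightarrow> 'g) \<Rightarrow> bool" where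
  "groupoid_automorphism G \<phi> \<longleftrightarrow> homeomorphic_map (gtop G) (gtop G) \<phi> \<and>
     (\<forall>(g, h)\<in>comp_pairs G.
        (\<phi> g, \<phi> h) \<in> comp_pairs G \<and> \<phi> (gmult G g h) = gmult G (\<phi> g) (\<phi> h))"

definition acts_by_automorphisms ::
    "('a, 'm) monoid_scheme \<Rightarrow> 'g top_groupoid \<Rightarrow> ('a \<Rightarrow> 'g \<Rightarrow> 'g) \<Rightarrow> bool" where
  "acts_by_automorphisms \<Gamma> G \<alpha> \<longleftrightarrow>
     (\<forall>a\<in>carrier \<Gamma>. groupoid_automorphism G (\<alpha> a)) \<and>
     (\<forall>g\<in>arrows G. \<alpha> \<one>\<^bsub>\<Gamma>\<^esub> g = g) \<and>
     (\<forall>a\<in>carrier \<Gamma>. \<forall>b\<in>carrier \<Gamma>. \<forall>g\<in>arrows G. \<alpha> (a \<otimes>\<^bsub>\<Gamma>\<^esub> b) g = \<alpha> a (\<alpha> b g))"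

definition free_on_units ::
    "('a, 'm) monoid_scheme \<Rightarrow> 'g top_groupoid \<Rightarrow> ('a \<Rightarrow> 'g \<Rightarrow> 'g) \<Rightarrow> bool" where
  "free_on_units \<Gamma> G \<alpha> \<longleftrightarrow>
     (\<forall>a\<in>carrier \<Gamma>. \<forall>x\<in>unit_space G. \<alpha> a x = x \<longrightarrow> a = \<one>\<^bsub>\<Gamma>\<^esub>)"

text \<open>
  The acting group carries the discrete topology. The inverse is the one forced by the
  multiplication; \<open>rng_semidirect\<close> and \<open>src_semidirect\<close> below recover \<open>r(g,a) = r(g)\<close> and
  \<open>s(g,a) = \<alpha>\<^sub>a\<^sup>-\<^sup>1(s(g))\<close>, where a unit \<open>x\<close> is identified with \<open>(x, \<one>)\<close>.
\<close>

definition semidirect ::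
    "'g top_groupoid \<Rightarrow> ('a, 'm) monoid_scheme \<Rightarrow> ('a \<Rightarrow> 'g \<Rightarrow> 'g) \<Rightarrow> ('g \<times> 'a) top_groupoid" where
  "semidirect G \<Gamma> \<alpha> =
     \<lparr>gtop = prod_topology (gtop G) (discrete_topology (carrier \<Gamma>)),
      gmult = (\<lambda>(g, a) (h, b). (gmult G g (\<alpha> a h), a \<otimes>\<^bsub>\<Gamma>\<^esub> b)),
      ginv = (\<lambda>(g, a). (\<alpha> (inv\<^bsub>\<Gamma>\<^esub> a) (ginv G g), inv\<^bsub>\<Gamma>\<^esub> a))\<rparr>"

lemma arrows_semidirect: "arrows (semidirect G \<Gamma> \<alpha>) = arrows G \<times> carrier \<Gamma>"
  by (simp add: arrows_def semidirect_def)

lemma groupoid_inv_comp: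
  assumes "groupoid G" "g \<in> arrows G"
  shows "ginv G g \<in> arrows G" "(g, ginv G g) \<in> comp_pairs G" "(ginv G g, g) \<in> comp_pairs G"
proof -
  have *: "ginv G g \<in> arrows G \<and> src G (ginv G g) = rng G g \<and> rng G (ginv G g) = src G g"
    using assms unfolding groupoid_def by blast
  then show "ginv G g \<in> arrows G" "(g, ginv G g) \<in> comp_pairs G" "(ginv G g, g) \<in> comp_pairs G"
    using assms(2) unfolding comp_pairs_def by simp_all
qed

lemma rng_semidirect:
  assumes "groupoid G" "Group.group \<Gamma>" "acts_by_automorphisms \<Gamma> G \<alpha>"
    and "g \<in> arrows G" "a \<in> carrier \<Gamma>"
  shows "rng (semidirect G \<Gamma> \<alpha>) (g, a) = (rng G g, \<one>\<^bsub>\<Gamma>\<^esub>)"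
proof -
  interpret Group.group \<Gamma> by fact
  have "\<alpha> a (\<alpha> (inv\<^bsub>\<Gamma>\<^esub> a) (ginv G g)) = ginv G g"
    using assms(3,5) groupoid_inv_comp(1)[OF assms(1,4)] inv_closed[OF assms(5)] r_inv[OF assms(5)]
    unfolding acts_by_automorphisms_def by metis
  then show ?thesis
    using r_inv[OF assms(5)] by (simp add: rng_def semidirect_def)
qed

lemma src_semidirect:
  assumes "groupoid G" "Group.group \<Gamma>" "acts_by_automorphisms \<Gamma> G \<alpha>"
    and "g \<in> arrows G" "a \<in> carrier \<Gamma>"
  shows "src (semidirect G \<Gamma> \<alpha>) (g, a) = (\<alpha> (inv\<^bsub>\<Gamma>\<^esub> a) (src G g), \<one>\<^bsub>\<Gamma>\<^esub>)"
proof -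
  interpret Group.group \<Gamma> by fact
  have "groupoid_automorphism G (\<alpha> (inv\<^bsub>\<Gamma>\<^esub> a))"
    using assms(3) inv_closed[OF assms(5)] unfolding acts_by_automorphisms_def by blast
  then have "\<alpha> (inv\<^bsub>\<Gamma>\<^esub> a) (src G g) = gmult G (\<alpha> (inv\<^bsub>\<Gamma>\<^esub> a) (ginv G g)) (\<alpha> (inv\<^bsub>\<Gamma>\<^esub> a) g)"
    using groupoid_inv_comp(3)[OF assms(1,4)]
    unfolding groupoid_automorphism_def src_def by blast
  then show ?thesis
    using l_inv[OF assms(5)] by (simp add: src_def semidirect_def)
qed

end

theory Submission
  imports Defs
begin

text \<open>
  Let \<open>L\<close> be a wide open subgroupoid of \<open>G \<rtimes> \<Gamma>\<close> containing \<open>G\<close>. For each \<open>a \<in> \<Gamma>\<close> the set of units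
  \<open>x\<close> with \<open>(x, a) \<in> L\<close> is open and \<open>G\<close>-invariant, hence empty or everything by minimality of \<open>G\<close>.
  So \<open>L = G \<times> A\<close> for a subgroup \<open>A\<close> of \<open>\<Gamma>\<close>, and a group of prime order has only the two trivial
  subgroups.
\<close>

section \<open>Units and automorphisms\<close>

lemma groupoid_compD:
  assumes "groupoid G" "(g, h) \<in> comp_pairs G"
  shows "gmult G g h \<in> arrows G" "src G (gmult G g h) = src G h" "rng G (gmult G g h) = rng G g"
  using assms unfolding groupoid_def by blast+

lemma groupoid_assoc:
  assumes "groupoid G" "(g, h) \<in> comp_pairs G" "(h, k) \<in> comp_pairs G"
  shows "gmult G (gmult G g h) k = gmult G g (gmult G h k)"
  using assms unfolding groupoid_def by blast

lemma groupoid_identity: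
  assumes "groupoid G" "g \<in> arrows G"
  shows "gmult G g (src G g) = g" "gmult G (rng G g) g = g"
  using assms unfolding groupoid_def by blast+

lemma src_rng_ginv:
  assumes "groupoid G" "g \<in> arrows G"
  shows "src G (ginv G g) = rng G g" "rng G (ginv G g) = src G g"
  using assms unfolding groupoid_def by blast+

lemma src_in_unit_space: "g \<in> arrows G \<Longrightarrow> src G g \<in> unit_space G"
  by (simp add: unit_space_def)

lemma rng_in_unit_space:
  assumes "groupoid G" "g \<in> arrows G"
  shows "rng G g \<in> unit_space G"
  using src_in_unit_space[OF groupoid_inv_comp(1)[OF assms]] src_rng_ginv(1)[OF assms] by simp

lemma unit_space_arrows:
  assumes "groupoid G" "x \<in> unit_space G"
  shows "x \<in> arrows G" "src G x = x" "rng G x = x"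
proof -
  obtain g where g: "g \<in> arrows G" and x: "x = src G g"
    using assms(2) by (auto simp: unit_space_def)
  note prod = groupoid_compD[OF assms(1) groupoid_inv_comp(3)[OF assms(1) g], folded src_def]
  show "x \<in> arrows G" "src G x = x" "rng G x = x"
    using prod src_rng_ginv(2)[OF assms(1) g] x by simp_all
qed

lemma unit_space_mult_self:
  assumes "groupoid G" "x \<in> unit_space G"
  shows "gmult G x x = x"
  using groupoid_identity(1)[OF assms(1)] unit_space_arrows[OF assms] by metis

text \<open>Multiplying \<open>gmult G y y = y\<close> on the left by the inverse cancels one factor
  and leaves \<open>y = src G y\<close>. This describes units through multiplication alone.\<close>

lemma idempotent_in_unit_space:
  assumes G: "groupoid G" and y: "(y, y) \<in> comp_pairs G" "gmult G y y = y"
  shows "y \<in> unit_space G"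
proof -
  have arr: "y \<in> arrows G" and sr: "src G y = rng G y"
    using y(1) by (auto simp: comp_pairs_def)
  have "y = gmult G (src G y) y"
    using groupoid_identity(2)[OF G arr] sr by simp
  also have "\<dots> = gmult G (ginv G y) (gmult G y y)"
    unfolding src_def by (rule groupoid_assoc[OF G groupoid_inv_comp(3)[OF G arr] y(1)])
  also have "\<dots> = src G y"
    using y(2) by (simp add: src_def)
  finally show ?thesis
    using src_in_unit_space[OF arr] by simp
qed

lemma groupoid_automorphism_compD:
  assumes "groupoid_automorphism G \<phi>" "(g, h) \<in> comp_pairs G"
  shows "(\<phi> g, \<phi> h) \<in> comp_pairs G" "\<phi> (gmult G g h) = gmult G (\<phi> g) (\<phi> h)"
  using assms unfolding groupoid_automorphism_def by blast+

lemma groupoid_automorphism_arrows: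
  assumes "groupoid_automorphism G \<phi>" "g \<in> arrows G"
  shows "\<phi> g \<in> arrows G"
  using assms homeomorphic_imp_surjective_map
  unfolding groupoid_automorphism_def arrows_def by blast

text \<open>\<open>groupoid_automorphism\<close> speaks of products only, so units are reached as
  idempotents, and being idempotent is preserved.\<close>

lemma groupoid_automorphism_unit_space:
  assumes G: "groupoid G" and \<phi>: "groupoid_automorphism G \<phi>" and x: "x \<in> unit_space G"
  shows "\<phi> x \<in> unit_space G"
proof -
  have "(x, x) \<in> comp_pairs G"
    using unit_space_arrows[OF G x] by (simp add: comp_pairs_def)
  from groupoid_automorphism_compD[OF \<phi> this] show ?thesis
    by (intro idempotent_in_unit_space[OF G]) (simp_all add: unit_space_mult_self[OF G x])
qed

text \<open>Apply \<open>\<phi>\<close> to the product of \<open>g\<close> with its inverse. The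
  image has the range of \<open>\<phi> g\<close>; it is also the unit
  \<open>\<phi> (rng G g)\<close>, hence its own range.\<close>

lemma groupoid_automorphism_rng:
  assumes G: "groupoid G" and \<phi>: "groupoid_automorphism G \<phi>" and g: "g \<in> arrows G"
  shows "rng G (\<phi> g) = \<phi> (rng G g)"
proof -
  note c = groupoid_automorphism_compD[OF \<phi> groupoid_inv_comp(2)[OF G g], folded rng_def]
  have "rng G (\<phi> g) = rng G (\<phi> (rng G g))"
    using groupoid_compD(3)[OF G c(1)] c(2) by simp
  also have "\<dots> = \<phi> (rng G g)"
    by (rule unit_space_arrows(3)[OF G
          groupoid_automorphism_unit_space[OF G \<phi> rng_in_unit_space[OF G g]]])
  finally show ?thesis .
qed

text \<open>The orbit of any unit \<open>y\<close> is dense, so some arrow with source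
  \<open>y\<close> has its range in \<open>U\<close>; \<open>inv\<close> then carries membership
  back to \<open>y\<close>.\<close>

lemma minimal_invariant_open:
  assumes "minimal G" and U: "openin (unit_top G) U" "U \<noteq> {}"
    and inv: "\<And>g. g \<in> arrows G \<Longrightarrow> rng G g \<in> U \<Longrightarrow> src G g \<in> U"
  shows "U = unit_space G"
proof
  show sub: "U \<subseteq> unit_space G"
    using openin_subset[OF U(1)] by (auto simp: unit_top_def)
  show "unit_space G \<subseteq> U"
  proof
    fix y assume y: "y \<in> unit_space G"
    obtain x where x: "x \<in> U" using U(2) by blast
    have "x \<in> unit_top G closure_of groupoid_orbit G y"
      using assms(1) y x sub unfolding minimal_def by blast
    then obtain z where "z \<in> groupoid_orbit G y" "z \<in> U"
      using x U(1) unfolding in_closure_of by blast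
    then show "y \<in> U"
      using inv by (auto simp: groupoid_orbit_def)
  qed
qed

section \<open>Intermediate subgroupoids of a semidirect product\<close>

lemma wide_subgroupoid_iff:
  "wide_subgroupoid K G \<longleftrightarrow> subgroupoid K G \<and> src G ` K = unit_space G"
  by (auto simp: wide_subgroupoid_def subgroupoid_def unit_space_def restrict_groupoid_def
      arrows_def src_def Int_absorb1)

locale groupoid_action =
  fixes G :: "'g top_groupoid" and \<Gamma> :: "('a, 'm) monoid_scheme" (structure)
    and \<alpha> :: "'a \<Rightarrow> 'g \<Rightarrow> 'g"
  assumes G: "groupoid G" and \<Gamma>: "Group.group \<Gamma>" and act: "acts_by_automorphisms \<Gamma> G \<alpha>"
begin

sublocale \<Gamma>: Group.group \<Gamma> by (fact \<Gamma>)

abbreviation "H \<equiv> semidirect G \<Gamma> \<alpha>"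

lemma aut: "a \<in> carrier \<Gamma> \<Longrightarrow> groupoid_automorphism G (\<alpha> a)"
  using act unfolding acts_by_automorphisms_def by blast

lemma act_one: "g \<in> arrows G \<Longrightarrow> \<alpha> \<one> g = g"
  using act unfolding acts_by_automorphisms_def by blast

lemma act_act_inv: "a \<in> carrier \<Gamma> \<Longrightarrow> g \<in> arrows G \<Longrightarrow> \<alpha> a (\<alpha> (inv a) g) = g"
  using act \<Gamma>.inv_closed \<Gamma>.r_inv unfolding acts_by_automorphisms_def by metis

lemmas act_arrows = groupoid_automorphism_arrows[OF aut]
lemmas act_unit = groupoid_automorphism_unit_space[OF G aut]
lemmas rngH = rng_semidirect[OF G \<Gamma> act]
lemmas srcH = src_semidirect[OF G \<Gamma> act]

lemma comp_pairs_semidirect: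
  assumes "g \<in> arrows G" "a \<in> carrier \<Gamma>" "h \<in> arrows G" "b \<in> carrier \<Gamma>"
  shows "((g, a), (h, b)) \<in> comp_pairs H \<longleftrightarrow> \<alpha> (inv a) (src G g) = rng G h"
  using assms by (simp add: comp_pairs_def arrows_semidirect rngH srcH)

lemma gmult_semidirect: "gmult H (g, a) (h, b) = (gmult G g (\<alpha> a h), a \<otimes> b)"
  by (simp add: semidirect_def)

lemma ginv_semidirect: "ginv H (g, a) = (\<alpha> (inv a) (ginv G g), inv a)"
  by (simp add: semidirect_def)

lemma unit_space_semidirect: "unit_space H = unit_space G \<times> {\<one>}"
proof
  show "unit_space H \<subseteq> unit_space G \<times> {\<one>}"
    using act_unit[OF \<Gamma>.inv_closed src_in_unit_space]
    by (auto simp: unit_space_def[of H] arrows_semidirect srcH)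
  show "unit_space G \<times> {\<one>} \<subseteq> unit_space H"
  proof clarify
    fix x assume "x \<in> unit_space G"
    then have "x \<in> arrows G" "src H (x, \<one>) = (x, \<one>)"
      using unit_space_arrows[OF G] by (simp_all add: srcH act_one)
    then show "(x, \<one>) \<in> unit_space H"
      using src_in_unit_space[of "(x, \<one>)" H] by (simp add: arrows_semidirect)
  qed
qed

text \<open>\<open>\<one>\<close> acts trivially, so on this slice the twisted operations are those
  of \<open>G\<close>; the slice is open because the group factor is discrete.\<close>

lemma wide_open_subgroupoid_base: "wide_open_subgroupoid (arrows G \<times> {\<one>}) H"
proof -
  have "subgroupoid (arrows G \<times> {\<one>}) H"
    using groupoid_inv_comp(1)[OF G] groupoid_compD(1)[OF G]
    by (auto simp: subgroupoid_def arrows_semidirect ginv_semidirect gmult_semidirect act_one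
        comp_pairs_semidirect src_in_unit_space unit_space_arrows[OF G] comp_pairs_def[of G])
  moreover have "src H ` (arrows G \<times> {\<one>}) = unit_space H"
  proof -
    have "src H ` (arrows G \<times> {\<one>}) = src G ` arrows G \<times> {\<one>}"
      by (force simp: srcH act_one src_in_unit_space unit_space_arrows[OF G])
    then show ?thesis
      by (simp add: unit_space_semidirect unit_space_def[of G])
  qed
  moreover have "openin (gtop H) (arrows G \<times> {\<one>})"
    by (simp add: semidirect_def openin_prod_Times_iff arrows_def)
  ultimately show ?thesis
    by (simp add: wide_open_subgroupoid_def wide_subgroupoid_iff)
qed

section \<open>Subgroupoids between the base groupoid and the semidirect product\<close>

context
  fixes L
  assumes L: "wide_open_subgroupoid L H" and base: "arrows G \<times> {\<one>} \<subseteq> L"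
begin

lemma intermediate_arrows: "(g, a) \<in> L \<Longrightarrow> g \<in> arrows G \<and> a \<in> carrier \<Gamma>"
  using L arrows_semidirect[of G \<Gamma> \<alpha>]
  by (auto simp: wide_open_subgroupoid_def wide_subgroupoid_def subgroupoid_def)

lemma intermediate_inv: "(g, a) \<in> L \<Longrightarrow> (\<alpha> (inv a) (ginv G g), inv a) \<in> L"
  using L ginv_semidirect
  unfolding wide_open_subgroupoid_def wide_subgroupoid_def subgroupoid_def by metis

lemma intermediate_mult:
  assumes "(g, a) \<in> L" "(h, b) \<in> L" "\<alpha> (inv a) (src G g) = rng G h"
  shows "(gmult G g (\<alpha> a h), a \<otimes> b) \<in> L"
proof -
  have "((g, a), (h, b)) \<in> comp_pairs H"
    using assms intermediate_arrows by (simp add: comp_pairs_semidirect)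
  then show ?thesis
    using L assms(1,2) gmult_semidirect
    unfolding wide_open_subgroupoid_def wide_subgroupoid_def subgroupoid_def by metis
qed

text \<open>Multiplication by \<open>(h, \<one>)\<close>, which lies in \<open>L\<close> by
  \<open>base\<close>, moves the arrow and keeps the group coordinate.\<close>

lemma intermediate_mult_left:
  assumes "h \<in> arrows G" "(g, a) \<in> L" "src G h = rng G g"
  shows "(gmult G h g, a) \<in> L"
proof -
  have ga: "g \<in> arrows G" "a \<in> carrier \<Gamma>"
    using intermediate_arrows[OF assms(2)] by simp_all
  show ?thesis
    using intermediate_mult[of h \<one> g a] assms ga base
    by (simp add: act_one subset_eq rng_in_unit_space[OF G] unit_space_arrows[OF G])
qed

lemma intermediate_rng:
  assumes "(g, a) \<in> L"
  shows "(rng G g, a) \<in> L"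
proof -
  have ga: "g \<in> arrows G" "a \<in> carrier \<Gamma>"
    using intermediate_arrows[OF assms] by simp_all
  have i: "ginv G g \<in> arrows G" using groupoid_inv_comp(1)[OF G ga(1)] .
  \<comment> \<open>A right factor gets twisted by \<open>\<alpha> a\<close>, so the inverse of
    \<open>g\<close> is twisted by \<open>inv a\<close> beforehand.\<close>
  let ?k = "\<alpha> (inv a) (ginv G g)"
  have "?k \<in> arrows G"
    using act_arrows i ga by simp
  moreover have "rng G ?k = \<alpha> (inv a) (src G g)"
    using groupoid_automorphism_rng[OF G aut i] ga src_rng_ginv(2)[OF G ga(1)] by simp
  ultimately have "(gmult G g (\<alpha> a ?k), a \<otimes> \<one>) \<in> L"
    using intermediate_mult[OF assms, of ?k \<one>] base by auto
  then show ?thesis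
    using act_act_inv[OF ga(2) i] ga by (simp add: rng_def)
qed

lemma intermediate_src:
  assumes "(g, a) \<in> L"
  shows "(src G g, a) \<in> L"
proof -
  have g: "g \<in> arrows G" using intermediate_arrows[OF assms] by simp
  show ?thesis
    using intermediate_mult_left[OF groupoid_inv_comp(1)[OF G g] assms src_rng_ginv(1)[OF G g]]
    by (simp add: src_def)
qed

text \<open>The units lying in \<open>L\<close> over a fixed \<open>a\<close> form an open set, the
  preimage of \<open>L\<close> under a continuous slice, and it contains \<open>src G g\<close>.
  Minimality finishes once this set is shown to be invariant.\<close>

lemma intermediate_units:
  assumes min: "minimal G" and ga: "(g, a) \<in> L" and x: "x \<in> unit_space G"
  shows "(x, a) \<in> L"
proof -
  have g: "g \<in> arrows G" and a: "a \<in> carrier \<Gamma>"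
    using intermediate_arrows[OF ga] by simp_all
  define U where "U = {x \<in> unit_space G. (x, a) \<in> L}"
  have "continuous_map (unit_top G) (gtop H) (\<lambda>x. (x, a))"
    using a by (simp add: semidirect_def unit_top_def continuous_map_pairwise comp_def
        continuous_map_from_subtopology)
  moreover have "topspace (unit_top G) = unit_space G"
    using unit_space_arrows(1)[OF G] by (auto simp: unit_top_def arrows_def)
  ultimately have "openin (unit_top G) U"
    using openin_continuous_map_preimage[of "unit_top G" "gtop H" "\<lambda>x. (x, a)" L] L
    by (simp add: U_def wide_open_subgroupoid_def)
  moreover have "U \<noteq> {}"
    using intermediate_src[OF ga] src_in_unit_space[OF g] by (auto simp: U_def)
  moreover have "src G h \<in> U" if h: "h \<in> arrows G" and r: "rng G h \<in> U" for h
  proof -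
    \<comment> \<open>The product is just the inverse of \<open>h\<close>, and the range of that
      inverse is \<open>src G h\<close>.\<close>
    have "(gmult G (ginv G h) (rng G h), a) \<in> L"
      using r by (intro intermediate_mult_left groupoid_inv_comp(1)[OF G h])
        (simp_all add: U_def src_rng_ginv[OF G h] unit_space_arrows[OF G])
    then have "(ginv G h, a) \<in> L"
      using groupoid_identity(1)[OF G groupoid_inv_comp(1)[OF G h]] src_rng_ginv[OF G h] by simp
    from intermediate_rng[OF this] show ?thesis
      using src_in_unit_space[OF h] src_rng_ginv[OF G h] by (simp add: U_def)
  qed
  ultimately have "U = unit_space G"
    using minimal_invariant_open[OF min] by blast
  then show ?thesis
    using x by (auto simp: U_def)
qed

text \<open>\<open>A\<close> is the projection of \<open>L\<close> to the group. Over each of its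
  elements the whole fibre is filled: a unit \<open>(src G h, a)\<close> in \<open>L\<close>,
  multiplied on the left by \<open>h\<close>, gives \<open>(h, a)\<close>.\<close>

lemma intermediate_subgroupoid_eq:
  assumes min: "minimal G" and ne: "arrows G \<noteq> {}"
  obtains A where "subgroup A \<Gamma>" "L = arrows G \<times> A"
proof
  let ?A = "snd ` L"
  show "L = arrows G \<times> ?A"
  proof (intro equalityI subsetI)
    fix z assume "z \<in> L"
    then show "z \<in> arrows G \<times> ?A"
      using intermediate_arrows by (cases z) force
  next
    fix z assume "z \<in> arrows G \<times> ?A"
    then obtain h g a where z: "z = (h, a)" and h: "h \<in> arrows G" and ga: "(g, a) \<in> L"
      by force
    have u: "src G h \<in> unit_space G" using src_in_unit_space[OF h] .
    have "(gmult G h (src G h), a) \<in> L"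
      using intermediate_mult_left[OF h intermediate_units[OF min ga u]]
        unit_space_arrows[OF G u] by simp
    then show "z \<in> L"
      using groupoid_identity(1)[OF G h] z by simp
  qed
  show "subgroup ?A \<Gamma>"
  proof
    show "?A \<subseteq> carrier \<Gamma>"
      using intermediate_arrows by force
    \<comment> \<open>An arrow must exist here, since otherwise the projection would be
      empty.\<close>
    show "\<one> \<in> ?A"
      using base ne by force
    show "inv a \<in> ?A" if "a \<in> ?A" for a
      using that intermediate_inv by force
    show "a \<otimes> b \<in> ?A" if "a \<in> ?A" "b \<in> ?A" for a b
    proof -
      obtain g h where g: "(g, a) \<in> L" and h: "(h, b) \<in> L"
        using \<open>a \<in> ?A\<close> \<open>b \<in> ?A\<close> by force
      \<comment> \<open>\<open>(g, a)\<close> and \<open>(h, b)\<close> need not be composable. The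
        unit \<open>y\<close> is the source of \<open>(g, a)\<close>, and
        \<open>intermediate_units\<close> allows \<open>(h, b)\<close> to be replaced by
        \<open>(y, b)\<close>.\<close>
      define y where "y = \<alpha> (inv a) (src G g)"
      have y: "y \<in> unit_space G"
        unfolding y_def using intermediate_arrows[OF g]
        by (intro act_unit \<Gamma>.inv_closed src_in_unit_space) simp_all
      have "(gmult G g (\<alpha> a y), a \<otimes> b) \<in> L"
        using intermediate_mult[OF g intermediate_units[OF min h y]]
          unit_space_arrows[OF G y] by (simp add: y_def)
      then show ?thesis by force
    qed
  qed
qed

end

text \<open>By Lagrange the subgroup \<open>A\<close> has order 1 or the full order of the group,
  which gives the two permitted cases for \<open>L\<close>.\<close>

lemma prime_subgroupoid_base:
  assumes "minimal G" "Factorial_Ring.prime (order \<Gamma>)"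
  shows "prime_subgroupoid (arrows G \<times> {\<one>}) H"
  unfolding prime_subgroupoid_def
proof (intro conjI allI impI wide_open_subgroupoid_base)
  fix L assume "wide_open_subgroupoid L H \<and> arrows G \<times> {\<one>} \<subseteq> L"
  then have L: "wide_open_subgroupoid L H" "arrows G \<times> {\<one>} \<subseteq> L" by simp_all
  show "L = arrows H \<or> L = arrows G \<times> {\<one>}"
  proof (cases "arrows G = {}")
    case True
    then have "L \<subseteq> {}"
      using intermediate_arrows[OF L] by auto
    then show ?thesis
      using True by simp
  next
    case False
    then obtain A where A: "subgroup A \<Gamma>" and LA: "L = arrows G \<times> A"
      by (rule intermediate_subgroupoid_eq[OF L assms(1)])
    \<comment> \<open>An infinite carrier would have \<open>order\<close> 0, which is not
      prime.\<close>
    have fin: "finite (carrier \<Gamma>)"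
      using prime_gt_0_nat[OF assms(2)] \<Gamma>.order_gt_0_iff_finite by simp
    have "card A dvd order \<Gamma>"
      by (rule dvdI[OF trans[OF \<Gamma>.lagrange[OF A, symmetric] mult.commute]])
    then consider "card A = 1" | "card A = order \<Gamma>"
      using assms(2) unfolding prime_nat_iff by blast
    then show ?thesis
    proof cases
      case 1
      then have "A = {\<one>}"
        using subgroup.one_closed[OF A] by (auto simp: card_1_singleton_iff)
      then show ?thesis using LA by simp
    next
      case 2
      then have "A = carrier \<Gamma>"
        using card_subset_eq[OF fin subgroup.subset[OF A]] by (simp add: order_def)
      then show ?thesis using LA by (simp add: arrows_semidirect)
    qed
  qed
qed

end

theorem lemma5p3:
  fixes p :: nat
    and G :: "'g top_groupoid"
    and \<alpha> :: "int \<Rightarrow> 'g \<Rightarrow> 'g"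
    and H :: "('g \<times> int) top_groupoid"
  assumes "Factorial_Ring.prime p"
    and "ample_groupoid G"
    and "cantor_space (unit_top G)"
    and "acts_by_automorphisms (integer_mod_group p) G \<alpha>"
    and "free_on_units (integer_mod_group p) G \<alpha>"
    and "H = semidirect G (integer_mod_group p) \<alpha>"
    and "effective G" and "effective H"
    and "minimal G" and "minimal H"
    and "almost_finite G \<or> purely_infinite G"
    and "almost_finite H \<or> purely_infinite H"
  shows "prime_subgroupoid (arrows G \<times> {0}) H"
proof -
  have "groupoid G"
    using assms(2) by (simp add: ample_groupoid_def etale_groupoid_def topological_groupoid_def)
  then interpret groupoid_action G "integer_mod_group p" \<alpha>
    using assms(4) by (intro groupoid_action.intro) simp_all
  \<comment> \<open>Positivity of \<open>p\<close> matters: \<open>integer_mod_group 0\<close> is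
    the group of all integers.\<close>
  have "order (integer_mod_group p) = p"
    using prime_gt_0_nat[OF assms(1)] by (simp add: order_def carrier_integer_mod_group)
  then show ?thesis
    using prime_subgroupoid_base assms(1,6,9) by simp
qed

end
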